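(* Let $J\ge 3$, let $\sigma_J$ be a permutation of $\{1,\dots,J\}$ such that $\sigma_J(J)=J$, and let $P_{\sigma_J}$ be the restricted permutation matrix of dimension $J-1$ given, for $i,j\in\{1,\dots,J-1\}$, by $(P_{\sigma_J})_{i,j}=1$ if $i=\sigma_J(j)$ and $(P_{\sigma_J})_{i,j}=0$ otherwise. Then, for every $F\in\mathfrak{F}$ and every $Z\in\mathfrak{Z}$, the following two models are equal: $$(\text{reference},F,Z)_{\sigma_J}=(\text{reference},F,P_{\sigma_J}Z).$$
   Context: Setting. Let $J\ge 3$ (number of categories), $p\ge 1$, and let $\mathcal{X}\subseteq\mathbb{R}^p$ be the nonempty set of values of the explanatory vector $x$. Let $\mathcal{M}=\{\pi\in\,]0,1[^{J-1} : \sum_{j=1}^{J-1}\pi_j<1\}$; for $\pi\in\mathcal{M}$ put $\pi_J=1-\sum_{j=1}^{J-1}\pi_j$ ($\pi_j$ is the probability of category $j$). Ratio. The reference ratio $r:\mathcal{M}\to\,]0,1[^{J-1}$ is $r_j(\pi)=\pi_j/(\pi_j+\pi_J)$, $j=1,\dots,J-1$; it is a bijection onto $]0,1[^{J-1}$. Cdfs. $\mathfrak{F}$ is the set of continuous cumulative distribution functions $F$ on $\mathbb{R}$ that are strictly increasing on the open interval $I_F=\{w: 0<F(w)<1\}$, so that $F$ maps $I_F$ bijectively onto $]0,1[$. Design matrices. The complete design matrix $Z_c(x)$ is the $(J-1)\times(J-1)(1+p)$ matrix with $Z_c(x)\beta=(\alpha_j+x^t\delta_j)_{j=1,\dots,J-1}$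 for $\beta=(\alpha_1,\dots,\alpha_{J-1},\delta_1^t,\dots,\delta_{J-1}^t)^t$, $\alpha_j\in\mathbb{R}$, $\delta_j\in\mathbb{R}^p$. The set $\mathfrak{Z}$ of design matrices consists of all matrix functions $Z:x\mapsto Z_c(x)C$, where $C$ is a constant real matrix of full column rank with $q$ columns, $J-1+p\le q\le (J-1)(1+p)$. For a constant matrix $M$ of dimension $J-1$, $MZ$ denotes $x\mapsto MZ(x)$. Models. A model $(r,F,Z)$, with $Z$ having $q$ columns, has as parameter space the set of $\beta\in\mathbb{R}^q$ such that for all $x\in\mathcal{X}$, $\eta=Z(x)\beta$ satisfies $\eta\in I_F^{J-1}$ and $(F(\eta_1),\dots,F(\eta_{J-1}))\in r(\mathcal{M})$. For such $\beta$ and $x\in\mathcal{X}$, it defines the unique $\pi=\pi(x;\beta)\in\mathcal{M}$ with $r(\pi)=(F(\eta_1),\dots,F(\eta_{J-1}))^t$, $\eta=Z(x)\beta$. Permuted models. For a permutation $\sigma$ of $\{1,\dots,J\}$ and $\pi\in\mathcal{M}$, let $\pi_\sigma=(\pi_{\sigma(1)},\dots,\pi_{\sigma(J-1)})\in\mathcal{M}$. The permuted model $(r,F,Z)_\sigma$ has the same parameter space as $(r,F,Z)$ and defines $\pi=\pi(x;\beta)\in\mathcal{M}$ by $r(\pi_\sigma)=(F(\eta_1),\dots,F(\eta_{J-1}))^t$, $\eta=Z(x)\beta$. Two (possibly permuted) models are equal if they have the same parameter space and give the same $\pi(x;\beta)$ for all $x\in\mathcal{X}$ and all $\beta$ in it.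 *)

theory Defs
  imports
    "HOL-Probability.Distribution_Functions"
    "HOL-Combinatorics.Permutations"
    "Jordan_Normal_Form.DL_Rank"
begin

unbundle no vec_syntax

text \<open>Categories are numbered \<open>1, \<dots>, J\<close>, whereas vectors and matrices are indexed from
  \<open>0\<close>; the quantity attached to category \<open>j < J\<close> is therefore entry \<open>j - 1\<close> of a vector of
  dimension \<open>J - 1\<close>.\<close>

definition prob_simplex :: "nat \<Rightarrow> real vec set" where
  "prob_simplex J =
     {\<pi> \<in> carrier_vec (J - 1).
        (\<forall>i<J - 1. 0 < \<pi> $ i \<and> \<pi> $ i < 1) \<and> (\<Sum>i<J - 1. \<pi> $ i) < 1}"

definition cat_prob :: "nat \<Rightarrow> real vec \<Rightarrow> nat \<Rightarrow> real" where
  "cat_prob J \<pi> j = (if j = J then 1 - (\<Sum>i<J - 1. \<pi> $ i) else \<pi> $ (j - 1))"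

definition reference_ratio :: "nat \<Rightarrow> real vec \<Rightarrow> real vec" where
  "reference_ratio J \<pi> =
     vec (J - 1) (\<lambda>i. cat_prob J \<pi> (Suc i) / (cat_prob J \<pi> (Suc i) + cat_prob J \<pi> J))"

lemma bij_betw_reference_ratio:
  "bij_betw (reference_ratio J) (prob_simplex J)
     {\<rho> \<in> carrier_vec (J - 1). \<forall>i<J - 1. 0 < \<rho> $ i \<and> \<rho> $ i < 1}"
proof -
  define m where "m = J - 1"
  define s where "s \<rho> = (\<Sum>i<m. \<rho> $ i / (1 - \<rho> $ i))" for \<rho> :: "real vec"
  define g where "g \<rho> = vec m (\<lambda>i. (\<rho> $ i / (1 - \<rho> $ i)) / (1 + s \<rho>))" for \<rho>
  define K where "K \<pi> = 1 - (\<Sum>i<m. \<pi> $ i)" for \<pi> :: "real vec"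
  have r: "reference_ratio J \<pi> = vec m (\<lambda>i. \<pi> $ i / (\<pi> $ i + K \<pi>))" for \<pi>
    by (rule eq_vecI) (auto simp: reference_ratio_def cat_prob_def m_def K_def)
  show ?thesis
  proof (rule bij_betw_byWitness[where f' = g], fold m_def)
    show "\<forall>\<pi>\<in>prob_simplex J. g (reference_ratio J \<pi>) = \<pi>"
    proof
      fix \<pi> assume p: "\<pi> \<in> prob_simplex J"
      have K: "K \<pi> > 0" and pos: "\<And>i. i < m \<Longrightarrow> \<pi> $ i > 0" and d: "\<pi> \<in> carrier_vec m"
        using p by (auto simp: prob_simplex_def m_def K_def)
      have o: "reference_ratio J \<pi> $ i / (1 - reference_ratio J \<pi> $ i) = \<pi> $ i / K \<pi>"
        if "i < m" for i
      proof -
        have "a / (a + k) / (1 - a / (a + k)) = a / k" if "a > 0" "k > 0" for a k :: real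
        proof -
          have "1 - a / (a + k) = k / (a + k)" using that by (simp add: field_simps)
          then show ?thesis using that by simp
        qed
        then show ?thesis using K pos[OF that] that by (simp add: r)
      qed
      have "s (reference_ratio J \<pi>) = (\<Sum>i<m. \<pi> $ i / K \<pi>)"
        unfolding s_def by (rule sum.cong) (auto simp: o)
      also have "\<dots> = (1 - K \<pi>) / K \<pi>" by (simp add: K_def sum_divide_distrib)
      finally have S: "1 + s (reference_ratio J \<pi>) = 1 / K \<pi>" using K by (simp add: field_simps)
      show "g (reference_ratio J \<pi>) = \<pi>"
      proof (rule eq_vecI)
        fix i assume "i < dim_vec \<pi>"
        then have i: "i < m" using d by simp
        then show "g (reference_ratio J \<pi>) $ i = \<pi> $ i"
          unfolding g_def S index_vec[OF i] o[OF i] using K by simp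
      qed (use d in \<open>simp add: g_def\<close>)
    qed
    have S: "s \<rho> \<ge> 0" if "\<forall>i<m. 0 < \<rho> $ i \<and> \<rho> $ i < 1" for \<rho>
      unfolding s_def using that by (intro sum_nonneg) (auto simp: less_imp_le)
    have sg: "(\<Sum>i<m. g \<rho> $ i) = s \<rho> / (1 + s \<rho>)" for \<rho>
      by (simp add: g_def s_def sum_divide_distrib)
    show "\<forall>\<rho>\<in>{\<rho> \<in> carrier_vec m. \<forall>i<m. 0 < \<rho> $ i \<and> \<rho> $ i < 1}.
            reference_ratio J (g \<rho>) = \<rho>"
    proof
      fix \<rho> :: "real vec" assume "\<rho> \<in> {\<rho> \<in> carrier_vec m. \<forall>i<m. 0 < \<rho> $ i \<and> \<rho> $ i < 1}"
      then have d: "dim_vec \<rho> = m" and a: "\<forall>i<m. 0 < \<rho> $ i \<and> \<rho> $ i < 1" by auto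
      have K: "K (g \<rho>) = 1 / (1 + s \<rho>)"
        using S[OF a] by (simp add: K_def sg field_simps)
      show "reference_ratio J (g \<rho>) = \<rho>"
      proof (rule eq_vecI)
        fix i assume "i < dim_vec \<rho>"
        then have i: "i < m" using d by simp
        have *: "a / (1 - a) / t / (a / (1 - a) / t + 1 / t) = a"
          if "a < 1" "0 < t" for a t :: real
        proof -
          have "a / (1 - a) / t + 1 / t = 1 / (1 - a) / t" using that by (simp add: field_simps)
          then show ?thesis using that by simp
        qed
        have "reference_ratio J (g \<rho>) $ i =
           \<rho> $ i / (1 - \<rho> $ i) / (1 + s \<rho>) / (\<rho> $ i / (1 - \<rho> $ i) / (1 + s \<rho>) + 1 / (1 + s \<rho>))"
          using i by (simp add: r K) (simp add: g_def)
        also have "\<dots> = \<rho> $ i" using a i S[OF a] by (intro *) auto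
        finally show "reference_ratio J (g \<rho>) $ i = \<rho> $ i" .
      qed (simp add: r d)
    qed
    show "reference_ratio J ` prob_simplex J
            \<subseteq> {\<rho> \<in> carrier_vec m. \<forall>i<m. 0 < \<rho> $ i \<and> \<rho> $ i < 1}"
      unfolding prob_simplex_def m_def[symmetric]
      by (auto simp: r K_def add_pos_pos)
    show "g ` {\<rho> \<in> carrier_vec m. \<forall>i<m. 0 < \<rho> $ i \<and> \<rho> $ i < 1} \<subseteq> prob_simplex J"
    proof clarify
      fix \<rho> :: "real vec" assume a: "\<forall>i<m. 0 < \<rho> $ i \<and> \<rho> $ i < 1"
      have pos: "\<And>i. i < m \<Longrightarrow> g \<rho> $ i > 0" using a S[OF a] by (auto simp: g_def)
      have l: "(\<Sum>i<m. g \<rho> $ i) < 1" using S[OF a] by (simp add: sg)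
      have "g \<rho> $ i < 1" if "i < m" for i
        using member_le_sum[of i "{..<m}" "\<lambda>i. g \<rho> $ i"] pos that l by (force simp: less_imp_le)
      moreover have "g \<rho> \<in> carrier_vec m" by (simp add: g_def)
      ultimately show "g \<rho> \<in> prob_simplex J"
        using pos l unfolding prob_simplex_def m_def[symmetric] by simp
    qed
  qed
qed

definition permute_prob :: "nat \<Rightarrow> (nat \<Rightarrow> nat) \<Rightarrow> real vec \<Rightarrow> real vec" where
  "permute_prob J \<sigma> \<pi> = vec (J - 1) (\<lambda>i. cat_prob J \<pi> (\<sigma> (Suc i)))"

definition cdf_support :: "(real \<Rightarrow> real) \<Rightarrow> real set" where
  "cdf_support F = {w. 0 < F w \<and> F w < 1}"

definition cdfs :: "(real \<Rightarrow> real) set" where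
  "cdfs = {F. (\<exists>M. real_distribution M \<and> F = cdf M) \<and>
              continuous_on UNIV F \<and> strict_mono_on (cdf_support F) F}"

text \<open>Parameters are ordered as \<open>(\<alpha>\<^sub>1, \<dots>, \<alpha>\<^bsub>J-1\<^esub>, \<delta>\<^sub>1, \<dots>, \<delta>\<^bsub>J-1\<^esub>)\<close>, so column
  \<open>J - 1 + i * p + k\<close> carries coordinate \<open>k\<close> of the slope vector in row \<open>i\<close>.\<close>

definition complete_design :: "nat \<Rightarrow> nat \<Rightarrow> real vec \<Rightarrow> real mat" where
  "complete_design J p x =
     mat (J - 1) ((J - 1) * (1 + p))
       (\<lambda>(i, c). if c < J - 1 then (if c = i then 1 else 0)
                 else if (c - (J - 1)) div p = i then x $ ((c - (J - 1)) mod p) else 0)"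

lemma complete_design_mult_vec:
  assumes b: "\<beta> \<in> carrier_vec ((J - 1) * (1 + p))" and i: "i < J - 1"
  shows "(complete_design J p x *\<^sub>v \<beta>) $ i =
           \<beta> $ i + x \<bullet> vec p (\<lambda>k. \<beta> $ (J - 1 + i * p + k))"
proof -
  define m where "m = J - 1"
  let ?g = "\<lambda>c. (if c div p = i then x $ (c mod p) else 0) * \<beta> $ (m + c)"
  let ?f = "\<lambda>c. (if c < m then (if c = i then 1 else 0)
                 else if (c - m) div p = i then x $ ((c - m) mod p) else 0) * \<beta> $ c"
  have "(complete_design J p x *\<^sub>v \<beta>) $ i = (\<Sum>c\<in>{0..<m + m * p}. ?f c)"
    using assms unfolding complete_design_def m_def[symmetric] by (simp add: scalar_prod_def)
  also have "\<dots> = (\<Sum>c\<in>{0..<m}. ?f c) + (\<Sum>c\<in>{m..<m + m * p}. ?f c)"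
    by (rule sum.atLeastLessThan_concat[symmetric]) auto
  also have "(\<Sum>c\<in>{0..<m}. ?f c) = (\<Sum>c\<in>{0..<m}. if c = i then \<beta> $ c else 0)"
    by (rule sum.cong) auto
  also have "\<dots> = \<beta> $ i" using i by (simp add: m_def)
  also have "(\<Sum>c\<in>{m..<m + m * p}. ?f c) = (\<Sum>c\<in>{0..<m * p}. ?g c)"
    by (rule sum.reindex_bij_witness[of _ "\<lambda>c. m + c" "\<lambda>c. c - m"]) auto
  also have "\<dots> = (\<Sum>c\<in>{i * p..<i * p + p}. ?g c)"
  proof (rule sum.mono_neutral_right)
    have "i * p + p \<le> m * p" using i mult_le_mono1[of "Suc i" m p] by (simp add: m_def)
    then show "{i * p..<i * p + p} \<subseteq> {0..<m * p}" by auto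
    show "\<forall>c\<in>{0..<m * p} - {i * p..<i * p + p}. ?g c = 0"
    proof (intro ballI)
      fix c assume c: "c \<in> {0..<m * p} - {i * p..<i * p + p}"
      then have p: "p > 0" by (cases p) auto
      have "c div p \<noteq> i"
      proof
        assume "c div p = i"
        then have "c = i * p + c mod p" by auto
        moreover have "c mod p < p" using p by simp
        ultimately show False using c by auto
      qed
      then show "?g c = 0" by simp
    qed
  qed auto
  also have "\<dots> = (\<Sum>k\<in>{0..<p}. ?g (i * p + k))"
    by (rule sum.reindex_bij_witness[of _ "\<lambda>c. i * p + c" "\<lambda>c. c - i * p"]) auto
  also have "\<dots> = (\<Sum>k\<in>{0..<p}. x $ k * \<beta> $ (m + i * p + k))"
    by (rule sum.cong) (auto simp: add.assoc)
  finally show ?thesis by (simp add: scalar_prod_def m_def)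
qed

definition design_matrices :: "nat \<Rightarrow> nat \<Rightarrow> nat \<Rightarrow> (real vec \<Rightarrow> real mat) set" where
  "design_matrices J p q =
     {(\<lambda>x. complete_design J p x * C) | C.
        J - 1 + p \<le> q \<and> q \<le> (J - 1) * (1 + p) \<and>
        C \<in> carrier_mat ((J - 1) * (1 + p)) q \<and>
        vec_space.rank ((J - 1) * (1 + p)) C = q}"

text \<open>A model is represented by its parameter space and the map sending \<open>x\<close> and \<open>\<beta>\<close>
  to \<open>\<pi>(x; \<beta>)\<close>.\<close>

type_synonym cat_model = "real vec set \<times> (real vec \<Rightarrow> real vec \<Rightarrow> real vec)"

definition param_space ::
  "nat \<Rightarrow> real vec set \<Rightarrow> nat \<Rightarrow> (real vec \<Rightarrow> real vec) \<Rightarrow> (real \<Rightarrow> real) \<Rightarrow>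
   (real vec \<Rightarrow> real mat) \<Rightarrow> real vec set" where
  "param_space J X q r F Z =
     {\<beta> \<in> carrier_vec q. \<forall>x\<in>X.
        (\<forall>i<J - 1. (Z x *\<^sub>v \<beta>) $ i \<in> cdf_support F) \<and>
        map_vec F (Z x *\<^sub>v \<beta>) \<in> r ` prob_simplex J}"

definition model ::
  "nat \<Rightarrow> real vec set \<Rightarrow> nat \<Rightarrow> (real vec \<Rightarrow> real vec) \<Rightarrow> (real \<Rightarrow> real) \<Rightarrow>
   (real vec \<Rightarrow> real mat) \<Rightarrow> cat_model" where
  "model J X q r F Z =
     (param_space J X q r F Z,
      \<lambda>x \<beta>. THE \<pi>. \<pi> \<in> prob_simplex J \<and> r \<pi> = map_vec F (Z x *\<^sub>v \<beta>))"

definition permuted_model ::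
  "nat \<Rightarrow> real vec set \<Rightarrow> nat \<Rightarrow> (real vec \<Rightarrow> real vec) \<Rightarrow> (real \<Rightarrow> real) \<Rightarrow>
   (real vec \<Rightarrow> real mat) \<Rightarrow> (nat \<Rightarrow> nat) \<Rightarrow> cat_model" where
  "permuted_model J X q r F Z \<sigma> =
     (param_space J X q r F Z,
      \<lambda>x \<beta>. THE \<pi>. \<pi> \<in> prob_simplex J \<and>
                   r (permute_prob J \<sigma> \<pi>) = map_vec F (Z x *\<^sub>v \<beta>))"

definition models_equal :: "real vec set \<Rightarrow> cat_model \<Rightarrow> cat_model \<Rightarrow> bool" where
  "models_equal X A B \<longleftrightarrow>
     fst A = fst B \<and> (\<forall>x\<in>X. \<forall>\<beta>\<in>fst A. snd A x \<beta> = snd B x \<beta>)"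

definition restricted_perm_mat :: "nat \<Rightarrow> (nat \<Rightarrow> nat) \<Rightarrow> real mat" where
  "restricted_perm_mat J \<sigma> =
     mat (J - 1) (J - 1) (\<lambda>(i, j). if Suc i = \<sigma> (Suc j) then 1 else 0)"

end

theory Submission
  imports Defs
begin

text \<open>If \<open>\<sigma>\<close> fixes the reference category \<open>J\<close>, then \<open>\<pi>\<^sub>J\<close> is unchanged by the permutation, so
  \<open>r\<^sub>j(\<pi>\<^sub>\<sigma>) = r\<^bsub>\<sigma>(j)\<^esub>(\<pi>)\<close>. Likewise row \<open>\<sigma>(j)\<close> of \<open>P\<^sub>\<sigma>\<eta>\<close> is \<open>\<eta>\<^sub>j\<close>, so the two systems of equations for
  \<open>\<pi>\<close> are the same up to reordering. The parameter spaces agree because \<open>r(\<M>)\<close> is the whole open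
  cube, which is invariant under permuting coordinates.\<close>

text \<open>Transfers the permutation from categories, counted from 1, to vector entries, counted
  from 0. Injectivity and \<open>\<sigma> J = J\<close> keep \<open>\<sigma> (Suc i)\<close>
  different from \<open>J\<close>, and an injective self-map of a finite set is onto. The second
  part says that the truncated subtraction loses nothing.\<close>

lemma bij_betw_shifted_permutation:
  assumes s: "\<sigma> permutes {1..J}" and J: "\<sigma> J = J"
  shows "bij_betw (\<lambda>i. \<sigma> (Suc i) - 1) {..<J - 1} {..<J - 1}"
    and "\<And>i. i < J - 1 \<Longrightarrow> Suc (\<sigma> (Suc i) - 1) = \<sigma> (Suc i)"
proof -
  have inj: "inj \<sigma>" using s by (rule permutes_inj)
  have r: "1 \<le> \<sigma> (Suc i) \<and> \<sigma> (Suc i) < J" if "i < J - 1" for i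
  proof -
    have "\<sigma> (Suc i) \<in> {1..J}" using that permutes_in_image[OF s] by simp
    moreover have "\<sigma> (Suc i) \<noteq> J" using that J injD[OF inj, of "Suc i" J] by auto
    ultimately show ?thesis by auto
  qed
  show "Suc (\<sigma> (Suc i) - 1) = \<sigma> (Suc i)" if "i < J - 1" for i
    using r[OF that] by linarith
  have "inj_on (\<lambda>i. \<sigma> (Suc i) - 1) {..<J - 1}"
  proof (rule inj_onI)
    fix i k assume a: "i \<in> {..<J - 1}" "k \<in> {..<J - 1}" "\<sigma> (Suc i) - 1 = \<sigma> (Suc k) - 1"
    have "\<sigma> (Suc i) = \<sigma> (Suc k)" using a r[of i] r[of k] by auto
    then show "i = k" using injD[OF inj] by blast
  qed
  moreover have "(\<lambda>i. \<sigma> (Suc i) - 1) ` {..<J - 1} \<subseteq> {..<J - 1}" using r by fastforce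
  ultimately show "bij_betw (\<lambda>i. \<sigma> (Suc i) - 1) {..<J - 1} {..<J - 1}"
    by (simp add: bij_betw_def endo_inj_surj)
qed

lemma reference_ratio_permute_prob:
  assumes s: "\<sigma> permutes {1..J}" and J: "\<sigma> J = J" and i: "i < J - 1"
  shows "reference_ratio J (permute_prob J \<sigma> \<pi>) $ i = reference_ratio J \<pi> $ (\<sigma> (Suc i) - 1)"
proof -
  let ?t = "\<lambda>i. \<sigma> (Suc i) - 1"
  note b = bij_betw_shifted_permutation[OF s J]
  have t: "?t k < J - 1" if "k < J - 1" for k
    using bij_betwE[OF b(1)] that by auto
  have c: "cat_prob J \<pi> (\<sigma> (Suc k)) = \<pi> $ ?t k" if "k < J - 1" for k
    using t[OF that] b(2)[OF that] by (auto simp: cat_prob_def)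
  \<comment> \<open>The probability of category \<open>J\<close> is one minus this sum, so
    reindexing along the bijection shows that it is unchanged.\<close>
  have "(\<Sum>k<J - 1. permute_prob J \<sigma> \<pi> $ k) = (\<Sum>k<J - 1. \<pi> $ ?t k)"
    by (rule sum.cong) (auto simp: permute_prob_def c)
  also have "\<dots> = (\<Sum>k<J - 1. \<pi> $ k)"
    by (rule sum.reindex_bij_betw[OF b(1)])
  finally have "cat_prob J (permute_prob J \<sigma> \<pi>) J = cat_prob J \<pi> J"
    by (simp add: cat_prob_def)
  moreover have "cat_prob J (permute_prob J \<sigma> \<pi>) (Suc i) = cat_prob J \<pi> (\<sigma> (Suc i))"
    using i unfolding cat_prob_def[of J "permute_prob J \<sigma> \<pi>"] by (auto simp: permute_prob_def)
  ultimately show ?thesis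
    using i t[OF i] b(2)[OF i] by (simp add: reference_ratio_def)
qed

text \<open>By injectivity of \<open>\<sigma>\<close>, the row of index
  \<open>\<sigma> (Suc i) - 1\<close> has its only 1 in column \<open>i\<close>. Indexing by the
  image avoids the inverse permutation.\<close>

lemma restricted_perm_mat_mult_vec:
  assumes s: "\<sigma> permutes {1..J}" and J: "\<sigma> J = J"
    and v: "v \<in> carrier_vec (J - 1)" and i: "i < J - 1"
  shows "(restricted_perm_mat J \<sigma> *\<^sub>v v) $ (\<sigma> (Suc i) - 1) = v $ i"
proof -
  note b = bij_betw_shifted_permutation[OF s J]
  have t: "\<sigma> (Suc i) - 1 < J - 1" using bij_betwE[OF b(1)] i by auto
  have e: "\<sigma> (Suc i) = \<sigma> (Suc k) \<longleftrightarrow> k = i" for k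
    using injD[OF permutes_inj[OF s]] by blast
  have "(restricted_perm_mat J \<sigma> *\<^sub>v v) $ (\<sigma> (Suc i) - 1)
      = (\<Sum>k\<in>{0..<J - 1}. (if Suc (\<sigma> (Suc i) - 1) = \<sigma> (Suc k) then 1 else 0) * v $ k)"
    using t v by (simp add: restricted_perm_mat_def scalar_prod_def)
  also have "\<dots> = (\<Sum>k\<in>{0..<J - 1}. if k = i then v $ k else 0)"
    unfolding b(2)[OF i] e by (rule sum.cong) auto
  also have "\<dots> = v $ i" using i by simp
  finally show ?thesis .
qed

text \<open>\<open>F\<close> maps \<open>cdf_support F\<close> into the open unit interval and the
  reference ratio is onto the open cube, so the first condition of \<open>param_space\<close>
  implies the second. What remains is imposed on each coordinate separately.\<close>

lemma param_space_reference_ratio: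
  assumes "\<And>x. x \<in> X \<Longrightarrow> dim_row (Z x) = J - 1"
  shows "param_space J X q (reference_ratio J) F Z =
    {\<beta> \<in> carrier_vec q. \<forall>x\<in>X. \<forall>i<J - 1. (Z x *\<^sub>v \<beta>) $ i \<in> cdf_support F}"
proof -
  have im: "reference_ratio J ` prob_simplex J =
      {\<rho> \<in> carrier_vec (J - 1). \<forall>i<J - 1. 0 < \<rho> $ i \<and> \<rho> $ i < 1}"
    using bij_betw_reference_ratio by (rule bij_betw_imp_surj_on)
  have eq: "(\<forall>i<J - 1. v $ i \<in> cdf_support F) \<and> map_vec F v \<in> reference_ratio J ` prob_simplex J
      \<longleftrightarrow> (\<forall>i<J - 1. v $ i \<in> cdf_support F)" if "dim_vec v = J - 1" for v
    unfolding im using that by (auto simp: cdf_support_def intro: carrier_vecI)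
  show ?thesis
    unfolding param_space_def
    by (intro Collect_cong conj_cong refl ball_cong eq) (simp add: assms)
qed

theorem mainTheorem5:
  fixes J p q :: nat
    and X :: "real vec set"
    and \<sigma> :: "nat \<Rightarrow> nat"
    and F :: "real \<Rightarrow> real"
    and Z :: "real vec \<Rightarrow> real mat"
  assumes "J \<ge> 3" and "p \<ge> 1"
    and "X \<subseteq> carrier_vec p" and "X \<noteq> {}"
    and "\<sigma> permutes {1..J}" and "\<sigma> J = J"
    and "F \<in> cdfs"
    and "Z \<in> design_matrices J p q"
  shows "models_equal X
           (permuted_model J X q (reference_ratio J) F Z \<sigma>)
           (model J X q (reference_ratio J) F (\<lambda>x. restricted_perm_mat J \<sigma> * Z x))"
proof -
  let ?P = "restricted_perm_mat J \<sigma>" and ?t = "\<lambda>i. \<sigma> (Suc i) - 1"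
  note s = assms(5) and J = assms(6)
  have bij: "bij_betw ?t {..<J - 1} {..<J - 1}"
    by (rule bij_betw_shifted_permutation[OF s J])
  \<comment> \<open>\<open>Pv\<close> below describes only entries at indices \<open>?t i\<close>;
    since \<open>?t\<close> is onto, these are all the entries.\<close>
  have all: "(\<forall>i<J - 1. Q i) \<longleftrightarrow> (\<forall>i<J - 1. Q (?t i))" for Q
    using ball_simps(9)[of ?t "{..<J - 1}" Q] unfolding bij_betw_imp_surj_on[OF bij]
    by (simp add: Ball_def)
  have P: "?P \<in> carrier_mat (J - 1) (J - 1)" by (simp add: restricted_perm_mat_def)
  have Z: "Z x \<in> carrier_mat (J - 1) q" for x
    using assms(8) by (auto simp: design_matrices_def complete_design_def)
  have v: "Z x *\<^sub>v \<beta> \<in> carrier_vec (J - 1)" for x \<beta>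
    using Z[of x] by (intro carrier_vecI) simp
  have PZ: "(?P * Z x) *\<^sub>v \<beta> = ?P *\<^sub>v (Z x *\<^sub>v \<beta>)" if "\<beta> \<in> carrier_vec q" for x and \<beta> :: "real vec"
    using P Z that by (rule assoc_mult_mat_vec)
  note Pv = restricted_perm_mat_mult_vec[OF s J v]
  have "param_space J X q (reference_ratio J) F (\<lambda>x. ?P * Z x) =
      {\<beta> \<in> carrier_vec q. \<forall>x\<in>X. \<forall>i<J - 1. ((?P * Z x) *\<^sub>v \<beta>) $ i \<in> cdf_support F}"
    using P by (intro param_space_reference_ratio) auto
  also have "\<dots> = {\<beta> \<in> carrier_vec q. \<forall>x\<in>X. \<forall>i<J - 1. (Z x *\<^sub>v \<beta>) $ i \<in> cdf_support F}"
  proof (intro Collect_cong conj_cong refl ball_cong)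
    fix \<beta> :: "real vec" and x assume "\<beta> \<in> carrier_vec q"
    then show "(\<forall>i<J - 1. ((?P * Z x) *\<^sub>v \<beta>) $ i \<in> cdf_support F) \<longleftrightarrow>
        (\<forall>i<J - 1. (Z x *\<^sub>v \<beta>) $ i \<in> cdf_support F)"
      \<comment> \<open>The deleted rules would rewrite the index \<open>?t i\<close> or expand the
        entry into a scalar product before \<open>Pv\<close> can match.\<close>
      by (subst all) (simp add: PZ Pv del: One_nat_def index_mult_mat_vec)
  qed
  also have "\<dots> = param_space J X q (reference_ratio J) F Z"
    using Z by (intro param_space_reference_ratio[symmetric]) auto
  finally have space: "param_space J X q (reference_ratio J) F Z =
      param_space J X q (reference_ratio J) F (\<lambda>x. ?P * Z x)" ..
  \<comment> \<open>For each \<open>x\<close> and \<open>\<beta>\<close> the two \<open>THE\<close>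
    terms thus describe the same predicate of \<open>\<pi>\<close>, so the models give the same
    value.\<close>
  have "reference_ratio J (permute_prob J \<sigma> \<pi>) = map_vec F (Z x *\<^sub>v \<beta>) \<longleftrightarrow>
      reference_ratio J \<pi> = map_vec F ((?P * Z x) *\<^sub>v \<beta>)"
    if \<beta>: "\<beta> \<in> carrier_vec q" for x and \<beta> \<pi> :: "real vec"
  proof -
    have dim: "dim_vec (reference_ratio J \<rho>) = J - 1" for \<rho>
      by (simp add: reference_ratio_def)
    have dZ: "dim_row (Z x) = J - 1" and dP: "dim_row ?P = J - 1"
      using Z P by auto
    have "reference_ratio J \<pi> = map_vec F ((?P * Z x) *\<^sub>v \<beta>) \<longleftrightarrow>
        (\<forall>i<J - 1. reference_ratio J \<pi> $ i = F ((?P *\<^sub>v (Z x *\<^sub>v \<beta>)) $ i))"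
      using dP by (auto simp: vec_eq_iff dim PZ[OF \<beta>])
    also have "\<dots> \<longleftrightarrow> (\<forall>i<J - 1. reference_ratio J \<pi> $ ?t i = F ((Z x *\<^sub>v \<beta>) $ i))"
      by (subst all) (simp add: Pv del: One_nat_def index_mult_mat_vec)
    also have "\<dots> \<longleftrightarrow> reference_ratio J (permute_prob J \<sigma> \<pi>) = map_vec F (Z x *\<^sub>v \<beta>)"
      using dZ by (auto simp: vec_eq_iff dim reference_ratio_permute_prob[OF s J])
    finally show ?thesis ..
  qed
  then show ?thesis
    using space by (simp add: models_equal_def model_def permuted_model_def param_space_def)
qed

end
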